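(* Let $g$ be a Lorentzian metric on a 4-dimensional spacetime $S$, let $h(x,p)$ be a smooth function on the 1-particle phase space $T^*S$, and let $\Xi=\Xi(M)$ be a perturbation parameter which may depend on the particle mass $M>0$. Suppose that the modified dispersion relation $$H(x,p) = g^{ab}(x)p_ap_b + \Xi(M)\, h(x,p) = M^2$$ is classically dynamically non-trivial (as defined in the context). Then the weak equivalence principle is valid, i.e. the spatial acceleration $\frac{d^2x^\alpha}{dt^2}$ of a free particle of mass $M$ subject to this dispersion relation, computed to first order in $\Xi$ and regarded as a function of $(t,x^\alpha,v^\alpha)$, is independent of $M$, if and only if the product $\Xi h$ is homogeneous of degree $2$ with respect to the mass $M$, i.e. $\Xi(M)\,h(x,M\hat p)$, as a function of $M$ at fixed $(ct,x^\alpha,\epsilon^\alpha)$, is homogeneous of degree $2$. For an $n$-homogeneous perturbation function, $h(x,\lambda p)=\lambda^n h(x,p)$ for $\lambda>0$, this implies that the coupling is given by $\Xi(M) = M^{2-n}\,\hat\Xi$, where $\hat\Xi$ is a (dimensionless) number independent of $M$.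
   Context: Indices $a,b,c,\dots$ run over $0,\dots,3$ and $\alpha,\beta,\dots$ over $1,2,3$; the signature is $(+,-,-,-)$. Coordinates are $x^a=(ct,x^\alpha)$, with $c$ the speed of light, $v^\alpha = dx^\alpha/dt$ and $\epsilon^\alpha = v^\alpha/c$. Define on the domain where the square root is real and positive $$\mathfrak f(ct,x^\alpha,\epsilon^\alpha) = \sqrt{g_{00}+2g_{0\alpha}\epsilon^\alpha+g_{\alpha\beta}\epsilon^\alpha\epsilon^\beta},\qquad \hat p_c = \frac{g_{c0}+g_{c\alpha}\epsilon^\alpha}{\mathfrak f},\qquad \bar p_c = M\hat p_c,\qquad \bar h(ct,x^\alpha,\epsilon^\alpha)=h(ct,x^\alpha,\bar p(ct,x^\alpha,\epsilon^\alpha)).$$ Lower indices on $\mathfrak f$, $\bar h$, $\mathfrak f\bar h$ denote partial derivatives with respect to $\epsilon^\alpha$ (e.g. $\mathfrak f_\alpha=\partial\mathfrak f/\partial\epsilon^\alpha$, $(\mathfrak f\bar h)_{\alpha\beta}=\partial^2(\mathfrak f\bar h)/\partial\epsilon^\alpha\partial\epsilon^\beta$), while $\partial_\alpha=\partial/\partial x^\alpha$ and $\partial_t=\partial/\partial t$ are taken at fixed $\epsilon$. $\mathfrak f^{\alpha\beta}$ is the inverse of the matrix $\mathfrak f_{\alpha\beta}$ (assumed invertible). The particle motion is the one determined, to first order in $\Xi$, by the action $Mc^2\int f\,dt$ with $$f=\mathfrak f\left(1-\frac{\Xi}{2M^2}\bar h\right).$$ The resulting spatial acceleration to first order in $\Xi$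 is $$\mathfrak f_{\beta\alpha}\frac{d^2x^\beta}{dt^2} = a^{\rm GR}_\alpha-\frac{\Xi}{2M^2}B_\alpha,$$ $$B_\alpha = \bar h\,a^{\rm GR}_\alpha-\mathfrak f^{\sigma\gamma}(\mathfrak f\bar h)_{\alpha\sigma}a^{\rm GR}_\gamma+c^2\mathfrak f\,\partial_\alpha\bar h-c\big(\mathfrak f_\alpha(\partial_t\bar h+v^\gamma\partial_\gamma\bar h)+\partial_t(\mathfrak f\bar h_\alpha)+v^\gamma\partial_\gamma(\mathfrak f\bar h_\alpha)\big),$$ where $a^{\rm GR}_\alpha=c^2\partial_\alpha\mathfrak f-c(\partial_t\mathfrak f_\alpha+v^\gamma\partial_\gamma\mathfrak f_\alpha)$. The modified dispersion relation is called classically dynamically trivial if $B_\alpha$ vanishes identically (so that the perturbation does not influence the point-particle motion at all), and classically dynamically non-trivial otherwise. The weak equivalence principle (free-fall trajectories of test bodies are independent of their internal structure and composition) is understood here, for point particles whose only property is their mass $M$, as independence of the spatial acceleration above, to first order in $\Xi$, of $M$.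
   Formalization: "Only if" fails for general h (Minkowski, Ξ=1, h=x¹g^{ab}p_a p_b+1). Formally: WEP iff Ξh is 2-homogeneous in M up to a dynamically trivial term; literal iff if no nonzero combination of h(x,Mp̂), h(x,M'p̂) is trivial, or h is n-homogeneous. *)

theory Defs
  imports "HOL-Analysis.Analysis"
begin

section \<open>Smooth functions\<close>

text \<open>Only used on open sets \<open>S\<close>.\<close>

primrec Ck_on :: "nat \<Rightarrow> 'a::real_normed_vector set \<Rightarrow> ('a \<Rightarrow> 'b::real_normed_vector) \<Rightarrow> bool" where
  "Ck_on 0 S f \<longleftrightarrow> continuous_on S f"
| "Ck_on (Suc k) S f \<longleftrightarrow>
     (\<forall>x\<in>S. f differentiable (at x)) \<and>
     (\<forall>v. Ck_on k S (\<lambda>x. frechet_derivative f (at x) v))"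

definition smooth_on :: "'a::real_normed_vector set \<Rightarrow> ('a \<Rightarrow> 'b::real_normed_vector) \<Rightarrow> bool" where
  "smooth_on S f \<longleftrightarrow> (\<forall>k. Ck_on k S f)"


section \<open>Spacetime, metric and functions on phase space\<close>

text \<open>
  Coordinates are vectors in \<open>real ^ 4\<close> with components \<open>0, 1, 2, 3\<close>. A chart is a pair of a
  domain and a coordinate map.
\<close>

type_synonym 's chart = "'s set \<times> ('s \<Rightarrow> real ^ 4)"

definition coord_range :: "'s chart \<Rightarrow> (real ^ 4) set" where
  "coord_range \<kappa> = snd \<kappa> ` fst \<kappa>"

definition overlap :: "'s chart \<Rightarrow> 's chart \<Rightarrow> (real ^ 4) set" where
  "overlap \<kappa> \<mu> = snd \<kappa> ` (fst \<kappa> \<inter> fst \<mu>)"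

definition transition :: "'s chart \<Rightarrow> 's chart \<Rightarrow> real ^ 4 \<Rightarrow> real ^ 4" where
  "transition \<kappa> \<mu> X = snd \<mu> (inv_into (fst \<kappa>) (snd \<kappa>) X)"

text \<open>The Jacobian of new coordinates (\<open>\<mu>\<close>) with respect to old ones (\<open>\<kappa>\<close>); rows are new indices.\<close>

definition jacobian :: "'s chart \<Rightarrow> 's chart \<Rightarrow> real ^ 4 \<Rightarrow> real ^ 4 ^ 4" where
  "jacobian \<kappa> \<mu> X = matrix (frechet_derivative (transition \<kappa> \<mu>) (at X))"

text \<open>\<open>A\<close> need not be maximal, so a single global chart is allowed.\<close>

definition smooth_atlas ::
  "'s::{t2_space, second_countable_topology} set \<Rightarrow> 's chart set \<Rightarrow> bool" where
  "smooth_atlas S A \<longleftrightarrow>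
     (\<forall>\<kappa>\<in>A. openin (top_of_set S) (fst \<kappa>) \<and> open (coord_range \<kappa>) \<and>
        homeomorphism (fst \<kappa>) (coord_range \<kappa>) (snd \<kappa>) (inv_into (fst \<kappa>) (snd \<kappa>))) \<and>
     (\<Union>\<kappa>\<in>A. fst \<kappa>) = S \<and>
     (\<forall>\<kappa>\<in>A. \<forall>\<mu>\<in>A. smooth_on (overlap \<kappa> \<mu>) (transition \<kappa> \<mu>))"

definition minkowski :: "real ^ 4 ^ 4" where
  "minkowski = (\<chi> a b. if a = b then (if a = 0 then 1 else -1) else 0)"

definition lorentzian_matrix :: "real ^ 4 ^ 4 \<Rightarrow> bool" where
  "lorentzian_matrix G \<longleftrightarrow>
     transpose G = G \<and> (\<exists>E. invertible E \<and> transpose E ** G ** E = minkowski)"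

text \<open>
  A metric is given by its components \<open>g \<kappa> X $ a $ b\<close> in each chart \<open>\<kappa>\<close>, and a function on the
  cotangent bundle by its local expressions \<open>h \<kappa> X p\<close>, where \<open>p\<close> are the components of a covector.
  Both have to transform correctly between charts.
\<close>

definition lorentzian_metric :: "'s chart set \<Rightarrow> ('s chart \<Rightarrow> real ^ 4 \<Rightarrow> real ^ 4 ^ 4) \<Rightarrow> bool" where
  "lorentzian_metric A g \<longleftrightarrow>
     (\<forall>\<kappa>\<in>A. smooth_on (coord_range \<kappa>) (g \<kappa>) \<and>
        (\<forall>X\<in>coord_range \<kappa>. lorentzian_matrix (g \<kappa> X))) \<and>
     (\<forall>\<kappa>\<in>A. \<forall>\<mu>\<in>A. \<forall>X\<in>overlap \<kappa> \<mu>.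
        g \<kappa> X = transpose (jacobian \<kappa> \<mu> X) ** g \<mu> (transition \<kappa> \<mu> X) ** jacobian \<kappa> \<mu> X)"

definition phase_space_function ::
  "'s chart set \<Rightarrow> ('s chart \<Rightarrow> real ^ 4 \<Rightarrow> real ^ 4 \<Rightarrow> real) \<Rightarrow> bool" where
  "phase_space_function A h \<longleftrightarrow>
     (\<forall>\<kappa>\<in>A. smooth_on (coord_range \<kappa> \<times> UNIV) (\<lambda>(X, p). h \<kappa> X p)) \<and>
     (\<forall>\<kappa>\<in>A. \<forall>\<mu>\<in>A. \<forall>X\<in>overlap \<kappa> \<mu>. \<forall>p.
        h \<kappa> X (transpose (jacobian \<kappa> \<mu> X) *v p) = h \<mu> (transition \<kappa> \<mu> X) p)"


section \<open>Point-particle motion in one chart\<close>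

text \<open>
  Functions \<open>F X e\<close> depend on \<open>X = (ct, x\<^sup>\<alpha>)\<close> and \<open>e = v / c\<close>. Spatial indices have type \<open>3\<close>, where
  the numeral \<open>3\<close> denotes the same element as \<open>0\<close>; \<open>sp\<close> maps them to the spacetime
  indices \<open>1, 2, 3\<close>.
\<close>

definition sp :: "3 \<Rightarrow> 4" where
  "sp \<alpha> = (if \<alpha> = 1 then 1 else if \<alpha> = 2 then 2 else 3)"

definition pd_e :: "3 \<Rightarrow> (real ^ 4 \<Rightarrow> real ^ 3 \<Rightarrow> real) \<Rightarrow> real ^ 4 \<Rightarrow> real ^ 3 \<Rightarrow> real" where
  "pd_e \<alpha> F X e = deriv (\<lambda>s. F X (e + s *\<^sub>R axis \<alpha> 1)) 0"

definition pd_x :: "3 \<Rightarrow> (real ^ 4 \<Rightarrow> real ^ 3 \<Rightarrow> real) \<Rightarrow> real ^ 4 \<Rightarrow> real ^ 3 \<Rightarrow> real" where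
  "pd_x \<alpha> F X e = deriv (\<lambda>s. F (X + s *\<^sub>R axis (sp \<alpha>) 1) e) 0"

text \<open>This is the derivative with respect to \<open>t\<close>, not with respect to the component \<open>X $ 0 = ct\<close>.\<close>

definition pd_t :: "real \<Rightarrow> (real ^ 4 \<Rightarrow> real ^ 3 \<Rightarrow> real) \<Rightarrow> real ^ 4 \<Rightarrow> real ^ 3 \<Rightarrow> real" where
  "pd_t c F X e = deriv (\<lambda>s. F (X + (c * s) *\<^sub>R axis 0 1) e) 0"

text \<open>The operator \<open>\<partial>\<^sub>t + v\<^sup>\<gamma> \<partial>\<^sub>\<gamma>\<close> at fixed \<open>e\<close>.\<close>

definition transport :: "real \<Rightarrow> (real ^ 4 \<Rightarrow> real ^ 3 \<Rightarrow> real) \<Rightarrow> real ^ 4 \<Rightarrow> real ^ 3 \<Rightarrow> real" where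
  "transport c F X e = pd_t c F X e + (\<Sum>\<gamma>\<in>UNIV. (c * e $ \<gamma>) * pd_x \<gamma> F X e)"

definition radicand :: "real ^ 4 ^ 4 \<Rightarrow> real ^ 3 \<Rightarrow> real" where
  "radicand G e = G $ 0 $ 0 + 2 * (\<Sum>\<alpha>\<in>UNIV. G $ 0 $ sp \<alpha> * e $ \<alpha>)
     + (\<Sum>\<alpha>\<in>UNIV. \<Sum>\<beta>\<in>UNIV. G $ sp \<alpha> $ sp \<beta> * e $ \<alpha> * e $ \<beta>)"

definition ff :: "(real ^ 4 \<Rightarrow> real ^ 4 ^ 4) \<Rightarrow> real ^ 4 \<Rightarrow> real ^ 3 \<Rightarrow> real" where
  "ff G X e = sqrt (radicand (G X) e)"

definition p_hat :: "(real ^ 4 \<Rightarrow> real ^ 4 ^ 4) \<Rightarrow> real ^ 4 \<Rightarrow> real ^ 3 \<Rightarrow> real ^ 4" where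
  "p_hat G X e = (\<chi> a. (G X $ a $ 0 + (\<Sum>\<alpha>\<in>UNIV. G X $ a $ sp \<alpha> * e $ \<alpha>)) / ff G X e)"

definition h_bar ::
  "(real ^ 4 \<Rightarrow> real ^ 4 ^ 4) \<Rightarrow> (real ^ 4 \<Rightarrow> real ^ 4 \<Rightarrow> real) \<Rightarrow> real \<Rightarrow> real ^ 4 \<Rightarrow> real ^ 3 \<Rightarrow> real" where
  "h_bar G h M X e = h X (M *\<^sub>R p_hat G X e)"

definition hess_f :: "(real ^ 4 \<Rightarrow> real ^ 4 ^ 4) \<Rightarrow> real ^ 4 \<Rightarrow> real ^ 3 \<Rightarrow> real ^ 3 ^ 3" where
  "hess_f G X e = (\<chi> \<alpha> \<beta>. pd_e \<alpha> (pd_e \<beta> (ff G)) X e)"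

definition a_GR :: "real \<Rightarrow> (real ^ 4 \<Rightarrow> real ^ 4 ^ 4) \<Rightarrow> 3 \<Rightarrow> real ^ 4 \<Rightarrow> real ^ 3 \<Rightarrow> real" where
  "a_GR c G \<alpha> X e = c\<^sup>2 * pd_x \<alpha> (ff G) X e - c * transport c (pd_e \<alpha> (ff G)) X e"

text \<open>\<open>B\<^sub>\<alpha>\<close> as an operator on \<open>k\<close>, to be applied to \<open>k = h_bar G h M\<close>.\<close>

definition B_term ::
  "real \<Rightarrow> (real ^ 4 \<Rightarrow> real ^ 4 ^ 4) \<Rightarrow> (real ^ 4 \<Rightarrow> real ^ 3 \<Rightarrow> real)
     \<Rightarrow> 3 \<Rightarrow> real ^ 4 \<Rightarrow> real ^ 3 \<Rightarrow> real" where
  "B_term c G k \<alpha> X e =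
     k X e * a_GR c G \<alpha> X e
     - (\<Sum>\<sigma>\<in>UNIV. \<Sum>\<gamma>\<in>UNIV. matrix_inv (hess_f G X e) $ \<sigma> $ \<gamma>
          * pd_e \<alpha> (pd_e \<sigma> (\<lambda>Y u. ff G Y u * k Y u)) X e * a_GR c G \<gamma> X e)
     + c\<^sup>2 * ff G X e * pd_x \<alpha> k X e
     - c * (pd_e \<alpha> (ff G) X e * transport c k X e
            + transport c (\<lambda>Y u. ff G Y u * pd_e \<alpha> k Y u) X e)"

text \<open>
  The vector \<open>acc\<close> with
  \<open>(\<Sum>\<beta>. hess_f G X e $ \<beta> $ \<alpha> * acc $ \<beta>) = a_GR c G \<alpha> X e - \<xi> / (2 * M\<^sup>2) * B_term c G (h_bar G h M) \<alpha> X e\<close>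
  for all \<open>\<alpha>\<close>, where \<open>\<xi>\<close> is the value of the perturbation parameter at \<open>M\<close>.
\<close>

definition spatial_acceleration ::
  "real \<Rightarrow> (real ^ 4 \<Rightarrow> real ^ 4 ^ 4) \<Rightarrow> (real ^ 4 \<Rightarrow> real ^ 4 \<Rightarrow> real) \<Rightarrow> real \<Rightarrow> real
     \<Rightarrow> real ^ 4 \<Rightarrow> real ^ 3 \<Rightarrow> real ^ 3" where
  "spatial_acceleration c G h \<xi> M X e =
     (\<chi> \<alpha>. a_GR c G \<alpha> X e - \<xi> / (2 * M\<^sup>2) * B_term c G (h_bar G h M) \<alpha> X e)
       v* matrix_inv (hess_f G X e)"


section \<open>Triviality, weak equivalence principle and homogeneity\<close>

definition states :: "'s chart \<Rightarrow> ('s chart \<Rightarrow> real ^ 4 \<Rightarrow> real ^ 4 ^ 4) \<Rightarrow> ((real ^ 4) \<times> (real ^ 3)) set" where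
  "states \<kappa> g = {(X, e). X \<in> coord_range \<kappa> \<and> radicand (g \<kappa> X) e > 0}"

definition dynamically_trivial_at ::
  "real \<Rightarrow> 's chart set \<Rightarrow> ('s chart \<Rightarrow> real ^ 4 \<Rightarrow> real ^ 4 ^ 4)
     \<Rightarrow> ('s chart \<Rightarrow> real ^ 4 \<Rightarrow> real ^ 4 \<Rightarrow> real) \<Rightarrow> real \<Rightarrow> bool" where
  "dynamically_trivial_at c A g h M \<longleftrightarrow>
     (\<forall>\<kappa>\<in>A. \<forall>(X, e)\<in>states \<kappa> g. \<forall>\<alpha>. B_term c (g \<kappa>) (h_bar (g \<kappa>) (h \<kappa>) M) \<alpha> X e = 0)"

definition dynamically_trivial ::
  "real \<Rightarrow> 's chart set \<Rightarrow> ('s chart \<Rightarrow> real ^ 4 \<Rightarrow> real ^ 4 ^ 4)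
     \<Rightarrow> ('s chart \<Rightarrow> real ^ 4 \<Rightarrow> real ^ 4 \<Rightarrow> real) \<Rightarrow> bool" where
  "dynamically_trivial c A g h \<longleftrightarrow> (\<forall>M>0. dynamically_trivial_at c A g h M)"

definition weak_equivalence_principle ::
  "real \<Rightarrow> 's chart set \<Rightarrow> ('s chart \<Rightarrow> real ^ 4 \<Rightarrow> real ^ 4 ^ 4)
     \<Rightarrow> ('s chart \<Rightarrow> real ^ 4 \<Rightarrow> real ^ 4 \<Rightarrow> real) \<Rightarrow> (real \<Rightarrow> real) \<Rightarrow> bool" where
  "weak_equivalence_principle c A g h \<Xi> \<longleftrightarrow>
     (\<forall>\<kappa>\<in>A. \<forall>(X, e)\<in>states \<kappa> g. \<forall>M>0. \<forall>M'>0.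
        spatial_acceleration c (g \<kappa>) (h \<kappa>) (\<Xi> M) M X e
        = spatial_acceleration c (g \<kappa>) (h \<kappa>) (\<Xi> M') M' X e)"

text \<open>
  Homogeneity of degree 2 with respect to the mass, for a possibly mass-dependent function \<open>Q M\<close>
  on phase space.
\<close>

definition mass_homogeneous2 ::
  "'s chart set \<Rightarrow> ('s chart \<Rightarrow> real ^ 4 \<Rightarrow> real ^ 4 ^ 4)
     \<Rightarrow> (real \<Rightarrow> 's chart \<Rightarrow> real ^ 4 \<Rightarrow> real ^ 4 \<Rightarrow> real) \<Rightarrow> bool" where
  "mass_homogeneous2 A g Q \<longleftrightarrow>
     (\<forall>\<kappa>\<in>A. \<forall>(X, e)\<in>states \<kappa> g. \<forall>M>0. \<forall>l>0.
        h_bar (g \<kappa>) (Q (l * M) \<kappa>) (l * M) X e = l\<^sup>2 * h_bar (g \<kappa>) (Q M \<kappa>) M X e)"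

text \<open>
  The operator \<open>B\<^sub>\<alpha>\<close> has a kernel; it contains, for instance, all constants. A perturbation can
  therefore be non-trivial while its restrictions to different mass shells have a non-zero, trivial
  linear combination: \<open>B\<^sub>\<alpha>\<close> then does not determine the mass dependence of the perturbation.
  The next definition excludes this.
\<close>

definition no_trivial_part ::
  "real \<Rightarrow> 's chart set \<Rightarrow> ('s chart \<Rightarrow> real ^ 4 \<Rightarrow> real ^ 4 ^ 4)
     \<Rightarrow> ('s chart \<Rightarrow> real ^ 4 \<Rightarrow> real ^ 4 \<Rightarrow> real) \<Rightarrow> bool" where
  "no_trivial_part c A g h \<longleftrightarrow>
     (\<forall>M>0. \<forall>M'>0. \<forall>a b.
        (let k = (\<lambda>\<kappa> X e. a * h_bar (g \<kappa>) (h \<kappa>) M X e + b * h_bar (g \<kappa>) (h \<kappa>) M' X e) in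
          (\<forall>\<kappa>\<in>A. \<forall>(X, e)\<in>states \<kappa> g. \<forall>\<alpha>. B_term c (g \<kappa>) (k \<kappa>) \<alpha> X e = 0)
          \<longrightarrow> (\<forall>\<kappa>\<in>A. \<forall>(X, e)\<in>states \<kappa> g. k \<kappa> X e = 0)))"

definition momentum_homogeneous ::
  "'s chart set \<Rightarrow> real \<Rightarrow> ('s chart \<Rightarrow> real ^ 4 \<Rightarrow> real ^ 4 \<Rightarrow> real) \<Rightarrow> bool" where
  "momentum_homogeneous A n h \<longleftrightarrow>
     (\<forall>\<kappa>\<in>A. \<forall>X\<in>coord_range \<kappa>. \<forall>p. \<forall>l>0. h \<kappa> X (l *\<^sub>R p) = l powr n * h \<kappa> X p)"

end

theory Submission
  imports Defs
begin

text \<open>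
  On twice differentiable functions \<open>k\<close> the term \<open>B\<^sub>\<alpha>\<close> is linear in \<open>k\<close> and depends only on the germ
  of \<open>k\<close>. Since the Hessian of \<open>\<ff>\<close> is invertible, the acceleration at mass \<open>M\<close> determines
  \<open>\<Xi> M / M\<^sup>2 * B\<^sub>\<alpha>\<close>, so the weak equivalence principle says that the functions
  \<open>\<Xi> M / M\<^sup>2 * h_bar M\<close> agree for all \<open>M\<close> up to the kernel of \<open>B\<^sub>\<alpha>\<close>. If \<open>h\<close> is homogeneous of degree
  \<open>n\<close>, they are the multiples \<open>\<Xi> M * M powr (n - 2)\<close> of one function outside the kernel.
\<close>

section \<open>Twice differentiable functions\<close>

text \<open>\<open>B_term\<close> takes at most two derivatives of \<open>k\<close>, so this much
  differentiability carries its linearity. With the order fixed, the closure properties need no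
  induction on the order, as they would for \<open>Ck_on\<close>.\<close>

definition twice_diff_on :: "'a::euclidean_space set \<Rightarrow> ('a \<Rightarrow> 'b::real_normed_vector) \<Rightarrow> bool" where
  "twice_diff_on U f \<longleftrightarrow>
     (\<forall>z\<in>U. f differentiable (at z) \<and>
        (\<forall>v. (\<lambda>x. frechet_derivative f (at x) v) differentiable (at z)))"

lemma differentiable_transform_open:
  assumes "f differentiable (at z)" "open U" "z \<in> U" "\<And>x. x \<in> U \<Longrightarrow> f x = g x"
  shows "g differentiable (at z)"
proof -
  have "(f has_derivative frechet_derivative f (at z)) (at z)"
    using assms(1) by (simp add: frechet_derivative_works)
  from has_derivative_transform_within_open[OF this assms(2,3)] assms(4)
  show ?thesis by (auto intro: differentiableI)
qed

lemma frechet_derivative_transform_open: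
  assumes "f differentiable (at z)" "open U" "z \<in> U" "\<And>x. x \<in> U \<Longrightarrow> f x = g x"
  shows "frechet_derivative f (at z) = frechet_derivative g (at z)"
proof -
  have "(f has_derivative frechet_derivative f (at z)) (at z)"
    using assms(1) by (simp add: frechet_derivative_works)
  from has_derivative_transform_within_open[OF this assms(2,3)] assms(4)
  show ?thesis by (intro frechet_derivative_at) auto
qed

text \<open>By uniqueness of derivatives on an open set, \<open>D\<close> agrees with
  \<open>frechet_derivative\<close> throughout \<open>U\<close>, so the derivative may be supplied
  as an explicit formula.\<close>

lemma twice_diff_onI:
  assumes "open U"
    and D: "\<And>z. z \<in> U \<Longrightarrow> (f has_derivative D z) (at z)"
    and D2: "\<And>z v. z \<in> U \<Longrightarrow> (\<lambda>x. D x v) differentiable (at z)"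
  shows "twice_diff_on U f"
  unfolding twice_diff_on_def
proof (intro ballI conjI allI)
  fix z v assume z: "z \<in> U"
  show "f differentiable (at z)"
    using D[OF z] by (rule differentiableI)
  show "(\<lambda>x. frechet_derivative f (at x) v) differentiable (at z)"
    by (rule differentiable_transform_open[OF D2[OF z] assms(1) z])
      (simp add: frechet_derivative_at[OF D, symmetric])
qed

lemma twice_diff_onD:
  assumes "twice_diff_on U f" "z \<in> U"
  shows "f differentiable (at z)"
    and "(f has_derivative frechet_derivative f (at z)) (at z)"
    and "(\<lambda>x. frechet_derivative f (at x) v) differentiable (at z)"
  using assms unfolding twice_diff_on_def by (auto simp: frechet_derivative_works)

lemma smooth_on_imp_twice_diff_on: "smooth_on U f \<Longrightarrow> twice_diff_on U f"
  unfolding smooth_on_def twice_diff_on_def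
  by (drule spec[of _ "Suc (Suc 0)"]) simp

lemma twice_diff_on_cong:
  assumes "open U" "twice_diff_on U f" "\<And>z. z \<in> U \<Longrightarrow> f z = g z"
  shows "twice_diff_on U g"
proof (rule twice_diff_onI[OF assms(1)])
  fix z v assume z: "z \<in> U"
  show "(g has_derivative frechet_derivative f (at z)) (at z)"
    using twice_diff_onD(2)[OF assms(2) z] assms(1,3) z has_derivative_transform_within_open by blast
  show "(\<lambda>x. frechet_derivative f (at x) v) differentiable (at z)"
    using twice_diff_onD(3)[OF assms(2) z] .
qed

lemma twice_diff_on_const: "open U \<Longrightarrow> twice_diff_on U (\<lambda>z. k)"
  by (rule twice_diff_onI[where D = "\<lambda>z v. 0"]) auto

lemma twice_diff_on_bounded_linear:
  assumes "open U" "bounded_linear L" "twice_diff_on U f"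
  shows "twice_diff_on U (\<lambda>z. L (f z))"
proof (rule twice_diff_onI[OF assms(1)])
  fix z v assume z: "z \<in> U"
  show "((\<lambda>z. L (f z)) has_derivative (\<lambda>v. L (frechet_derivative f (at z) v))) (at z)"
    by (rule bounded_linear.has_derivative[OF assms(2) twice_diff_onD(2)[OF assms(3) z]])
  show "(\<lambda>x. L (frechet_derivative f (at x) v)) differentiable (at z)"
    using twice_diff_onD(3)[OF assms(3) z]
    unfolding differentiable_def using bounded_linear.has_derivative[OF assms(2)] by blast
qed

lemma twice_diff_on_id: "open U \<Longrightarrow> twice_diff_on U (\<lambda>z. z)"
  by (rule twice_diff_onI[where D = "\<lambda>z v. v"]) auto

lemma twice_diff_on_add:
  assumes "open U" "twice_diff_on U f" "twice_diff_on U g"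
  shows "twice_diff_on U (\<lambda>z. f z + g z)"
  by (rule twice_diff_onI[OF assms(1)
        , where D = "\<lambda>z v. frechet_derivative f (at z) v + frechet_derivative g (at z) v"])
    (auto intro!: has_derivative_add differentiable_add twice_diff_onD[OF assms(2)]
      twice_diff_onD[OF assms(3)])

lemma twice_diff_on_scaleR:
  fixes f :: "'a::euclidean_space \<Rightarrow> real"
  assumes "open U" "twice_diff_on U f" "twice_diff_on U g"
  shows "twice_diff_on U (\<lambda>z. f z *\<^sub>R g z)"
  by (rule twice_diff_onI[OF assms(1), where D = "\<lambda>z v. f z *\<^sub>R frechet_derivative g (at z) v
          + frechet_derivative f (at z) v *\<^sub>R g z"])
    (auto intro!: has_derivative_scaleR differentiable_add differentiable_scaleR
      twice_diff_onD[OF assms(2)] twice_diff_onD[OF assms(3)])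

lemma twice_diff_on_mult:
  fixes f :: "'a::euclidean_space \<Rightarrow> real"
  shows "open U \<Longrightarrow> twice_diff_on U f \<Longrightarrow> twice_diff_on U g \<Longrightarrow> twice_diff_on U (\<lambda>z. f z * g z)"
  using twice_diff_on_scaleR[of U f g] by simp

lemma twice_diff_on_sum:
  assumes "open U" "\<And>i. i \<in> I \<Longrightarrow> twice_diff_on U (f i)"
  shows "twice_diff_on U (\<lambda>z. \<Sum>i\<in>I. f i z)"
  using assms(2)
  by (induction I rule: infinite_finite_induct)
    (auto intro: twice_diff_on_const twice_diff_on_add assms(1))

lemma twice_diff_on_vec_lambda:
  fixes f :: "'i::finite \<Rightarrow> 'a::euclidean_space \<Rightarrow> real"
  assumes "open U" "\<And>i. twice_diff_on U (f i)"
  shows "twice_diff_on U (\<lambda>z. \<chi> i. f i z)"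
proof -
  have "(\<lambda>z. \<chi> i. f i z) = (\<lambda>z. \<Sum>i\<in>UNIV. f i z *\<^sub>R axis i 1)"
    by (auto simp: vec_eq_iff axis_def if_distrib cong: if_cong)
  then show ?thesis
    using assms by (auto intro!: twice_diff_on_sum twice_diff_on_scaleR twice_diff_on_const)
qed

lemma twice_diff_on_Pair:
  fixes f :: "'a::euclidean_space \<Rightarrow> 'b::real_normed_vector" and g :: "'a \<Rightarrow> 'c::real_normed_vector"
  assumes "open U" "twice_diff_on U f" "twice_diff_on U g"
  shows "twice_diff_on U (\<lambda>z. (f z, g z))"
proof -
  have *: "(\<lambda>z. (f z, g z)) = (\<lambda>z. (f z, 0) + (0, g z))" by auto
  have "bounded_linear (\<lambda>x::'b. (x, 0::'c))" "bounded_linear (\<lambda>x::'c. (0::'b, x))"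
    by (auto intro!: bounded_linear_Pair bounded_linear_ident bounded_linear_zero)
  from twice_diff_on_add[OF assms(1) twice_diff_on_bounded_linear[OF assms(1) this(1) assms(2)]
      twice_diff_on_bounded_linear[OF assms(1) this(2) assms(3)]]
  show ?thesis unfolding * .
qed

text \<open>Second derivatives of \<open>k\<close> are controlled only along a fixed direction,
  whereas the chain rule differentiates \<open>k\<close> along
  \<open>frechet_derivative f (at z) v\<close>, which varies with \<open>z\<close>. Expanding that
  direction in \<open>Basis\<close> leaves fixed directions with scalar coefficients.\<close>

lemma twice_diff_on_compose:
  fixes f :: "'a::euclidean_space \<Rightarrow> 'b::euclidean_space"
  assumes "open U" "twice_diff_on V k" "twice_diff_on U f" "\<And>z. z \<in> U \<Longrightarrow> f z \<in> V"
  shows "twice_diff_on U (\<lambda>z. k (f z))"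
proof (rule twice_diff_onI[OF assms(1)])
  let ?D = "\<lambda>z v. \<Sum>b\<in>Basis. (frechet_derivative f (at z) v \<bullet> b) *\<^sub>R frechet_derivative k (at (f z)) b"
  fix z v assume z: "z \<in> U"
  have k: "(k has_derivative frechet_derivative k (at (f z))) (at (f z))"
    using twice_diff_onD(2)[OF assms(2) assms(4)[OF z]] .
  interpret k: bounded_linear "frechet_derivative k (at (f z))"
    using k by (rule has_derivative_bounded_linear)
  have *: "frechet_derivative k (at (f z)) w = (\<Sum>b\<in>Basis. (w \<bullet> b) *\<^sub>R frechet_derivative k (at (f z)) b)" for w
    using linear_sum[OF k.linear, of "\<lambda>b. (w \<bullet> b) *\<^sub>R b" Basis]
    by (simp add: euclidean_representation k.scaleR)
  show "((\<lambda>z. k (f z)) has_derivative ?D z) (at z)"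
    using diff_chain_at[OF twice_diff_onD(2)[OF assms(3) z] k]
    unfolding o_def *[of "frechet_derivative f (at z) _"] .
  have "(\<lambda>x. frechet_derivative k (at (f x)) b) differentiable (at z)" for b
    using differentiable_chain_at[OF twice_diff_onD(1)[OF assms(3) z]
        twice_diff_onD(3)[OF assms(2) assms(4)[OF z]]] by (simp add: o_def)
  moreover have "(\<lambda>x. frechet_derivative f (at x) v \<bullet> b) differentiable (at z)" for b
    using twice_diff_onD(3)[OF assms(3) z] by (intro differentiable_inner differentiable_const)
  ultimately show "(\<lambda>x. ?D x v) differentiable (at z)"
    by (intro differentiable_sum ballI differentiable_scaleR finite_Basis) auto
qed

text \<open>General exponents cover both the square root in \<open>ff\<close> (exponent 1/2) and its
  reciprocal in \<open>p_hat\<close> (exponent -1/2).\<close>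

lemma twice_diff_on_powr: "twice_diff_on {0<..} (\<lambda>x::real. x powr a)"
proof (rule twice_diff_onI[where D = "\<lambda>x v. (a * x powr (a - 1)) * v"])
  have d: "((\<lambda>x. x powr a) has_derivative (\<lambda>v. (a * z powr (a - 1)) * v)) (at z)"
    if "0 < z" for z a :: real
    using has_real_derivative_powr[OF that] unfolding has_field_derivative_def .
  fix z v :: real assume "z \<in> {0<..}"
  then show "((\<lambda>x. x powr a) has_derivative (\<lambda>v. (a * z powr (a - 1)) * v)) (at z)"
    using d by auto
  have "(\<lambda>x. x powr (a - 1)) differentiable (at z)"
    using d[of z "a - 1"] \<open>z \<in> _\<close> unfolding differentiable_def by auto
  then show "(\<lambda>x. a * x powr (a - 1) * v) differentiable (at z)"
    by (intro differentiable_mult differentiable_const)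
qed auto

section \<open>Directional derivatives\<close>

text \<open>The partial derivatives in position, time and velocity are all instances of this one, so
  linearity has to be proved only once.\<close>

definition dir_deriv ::
  "'a \<times> 'b \<Rightarrow> ('a::euclidean_space \<Rightarrow> 'b::euclidean_space \<Rightarrow> real) \<Rightarrow> 'a \<Rightarrow> 'b \<Rightarrow> real" where
  "dir_deriv w F X e = deriv (\<lambda>s. F (X + s *\<^sub>R fst w) (e + s *\<^sub>R snd w)) 0"

lemma dir_deriv_frechet:
  assumes "case_prod F differentiable (at (X, e))"
  shows "dir_deriv w F X e = frechet_derivative (case_prod F) (at (X, e)) w"
proof -
  let ?D = "frechet_derivative (case_prod F) (at (X, e))"
  \<comment> \<open>The zero multiple of \<open>w\<close> writes the base point as the line at
    parameter 0, the form that the chain rule expects.\<close>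
  have D: "(case_prod F has_derivative ?D) (at ((X, e) + 0 *\<^sub>R w))"
    using assms by (simp add: frechet_derivative_works)
  have "((\<lambda>s. (X, e) + s *\<^sub>R w) has_derivative (\<lambda>s. s *\<^sub>R w)) (at 0)"
    by (auto intro!: derivative_eq_intros)
  from diff_chain_at[OF this D]
  have *: "((\<lambda>s. case_prod F ((X, e) + s *\<^sub>R w)) has_derivative (\<lambda>s. ?D (s *\<^sub>R w))) (at 0)"
    by (simp add: o_def)
  have "linear ?D" using D has_derivative_linear by blast
  then have "(\<lambda>s. ?D (s *\<^sub>R w)) = (*) (?D w)" by (auto simp: linear_cmul)
  with * have "((\<lambda>s. case_prod F ((X, e) + s *\<^sub>R w)) has_field_derivative ?D w) (at 0)"
    unfolding has_field_derivative_def by simp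
  moreover have "case_prod F ((X, e) + s *\<^sub>R w) = F (X + s *\<^sub>R fst w) (e + s *\<^sub>R snd w)" for s
    by (cases w) simp
  ultimately show ?thesis
    unfolding dir_deriv_def by (simp add: DERIV_imp_deriv)
qed

lemma dir_deriv_differentiable:
  assumes "open U" "twice_diff_on U (case_prod F)" "z \<in> U"
  shows "case_prod (dir_deriv w F) differentiable (at z)"
proof (rule differentiable_transform_open[OF twice_diff_onD(3)[OF assms(2,3), of w] assms(1,3)])
  fix x assume "x \<in> U"
  then show "frechet_derivative (case_prod F) (at x) w = case_prod (dir_deriv w F) x"
    using dir_deriv_frechet[of F "fst x" "snd x" w] twice_diff_onD(1)[OF assms(2)]
    by (cases x) auto
qed

text \<open>The derivative sees only the germ at \<open>(X, e)\<close>, so an identity on a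
  neighbourhood suffices. Later on, relations between the functions are known only at timelike
  states.\<close>

lemma dir_deriv_lincomb:
  assumes "open U" "(X, e) \<in> U"
    and F: "\<And>Y u. (Y, u) \<in> U \<Longrightarrow> F Y u = a * F1 Y u + b * F2 Y u"
    and d1: "case_prod F1 differentiable (at (X, e))"
    and d2: "case_prod F2 differentiable (at (X, e))"
  shows "dir_deriv w F X e = a * dir_deriv w F1 X e + b * dir_deriv w F2 X e"
proof -
  let ?G = "\<lambda>z. a * case_prod F1 z + b * case_prod F2 z"
  have G: "(?G has_derivative (\<lambda>v. a * frechet_derivative (case_prod F1) (at (X, e)) v
      + b * frechet_derivative (case_prod F2) (at (X, e)) v)) (at (X, e))"
    using d1 d2 by (intro has_derivative_add has_derivative_mult_right) 
      (auto simp: frechet_derivative_works)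
  have "(case_prod F has_derivative (\<lambda>v. a * frechet_derivative (case_prod F1) (at (X, e)) v
      + b * frechet_derivative (case_prod F2) (at (X, e)) v)) (at (X, e))"
    by (rule has_derivative_transform_within_open[OF G assms(1,2)]) (auto simp: F)
  from differentiableI[OF this] frechet_derivative_at[OF this, symmetric]
  show ?thesis
    by (simp add: dir_deriv_frechet d1 d2)
qed

lemma pd_e_eq: "pd_e \<alpha> = dir_deriv (0, axis \<alpha> 1)"
  and pd_x_eq: "pd_x \<alpha> = dir_deriv (axis (sp \<alpha>) 1, 0)"
  and pd_t_eq: "pd_t c = dir_deriv (c *\<^sub>R axis 0 1, 0)"
  by (intro ext; simp add: pd_e_def pd_x_def pd_t_def dir_deriv_def mult.commute)+

lemma transport_lincomb:
  assumes "open U" "(X, e) \<in> U"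
    and "\<And>Y u. (Y, u) \<in> U \<Longrightarrow> F Y u = a * F1 Y u + b * F2 Y u"
    and "case_prod F1 differentiable (at (X, e))"
    and "case_prod F2 differentiable (at (X, e))"
  shows "transport c F X e = a * transport c F1 X e + b * transport c F2 X e"
  unfolding transport_def pd_t_eq pd_x_eq
  by (simp add: dir_deriv_lincomb[OF assms] sum_distrib_left sum.distrib algebra_simps)

text \<open>Every summand is a coefficient free of \<open>k\<close> times \<open>k\<close> or a
  derivative expression linear in \<open>k\<close>. Where two derivatives are nested, the inner one
  is expanded at all points of \<open>U\<close>, so that the outer one again acts on a combination
  known on a neighbourhood.\<close>

lemma B_term_lincomb:
  assumes U: "open U" "(X, e) \<in> U"
    and k: "\<And>Y u. (Y, u) \<in> U \<Longrightarrow> k Y u = a * k1 Y u + b * k2 Y u"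
    and f: "twice_diff_on U (case_prod (ff G))"
    and k1: "twice_diff_on U (case_prod k1)"
    and k2: "twice_diff_on U (case_prod k2)"
  shows "B_term c G k \<alpha> X e = a * B_term c G k1 \<alpha> X e + b * B_term c G k2 \<alpha> X e"
proof -
  let ?f = "ff G"
  have prod: "twice_diff_on U (case_prod (\<lambda>Y u. ?f Y u * K Y u))"
    if "twice_diff_on U (case_prod K)" for K
    using twice_diff_on_mult[OF U(1) f that] by (simp add: case_prod_unfold)
  have fk: "dir_deriv w (\<lambda>Y u. ?f Y u * k Y u) Y u
      = a * dir_deriv w (\<lambda>Y u. ?f Y u * k1 Y u) Y u + b * dir_deriv w (\<lambda>Y u. ?f Y u * k2 Y u) Y u"
    if "(Y, u) \<in> U" for w Y u
    using twice_diff_onD(1)[OF prod[OF k1] that] twice_diff_onD(1)[OF prod[OF k2] that]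
    by (intro dir_deriv_lincomb[OF U(1) that]) (auto simp: k algebra_simps)
  have fk2: "dir_deriv v (dir_deriv w (\<lambda>Y u. ?f Y u * k Y u)) X e
      = a * dir_deriv v (dir_deriv w (\<lambda>Y u. ?f Y u * k1 Y u)) X e
        + b * dir_deriv v (dir_deriv w (\<lambda>Y u. ?f Y u * k2 Y u)) X e" for v w
    by (intro dir_deriv_lincomb[OF U fk]
        dir_deriv_differentiable[OF U(1) prod[OF k1] U(2)]
        dir_deriv_differentiable[OF U(1) prod[OF k2] U(2)])
  have kd: "dir_deriv w k Y u = a * dir_deriv w k1 Y u + b * dir_deriv w k2 Y u"
    if "(Y, u) \<in> U" for w Y u
    using twice_diff_onD(1)[OF k1 that] twice_diff_onD(1)[OF k2 that]
    by (intro dir_deriv_lincomb[OF U(1) that k]) auto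
  have fd: "case_prod (\<lambda>Y u. ?f Y u * dir_deriv w K Y u) differentiable (at (X, e))"
    if "twice_diff_on U (case_prod K)" for K w
    using differentiable_mult[OF twice_diff_onD(1)[OF f U(2)]
        dir_deriv_differentiable[OF U(1) that U(2)]]
    by (simp add: case_prod_unfold)
  have tf: "transport c (\<lambda>Y u. ?f Y u * dir_deriv w k Y u) X e
      = a * transport c (\<lambda>Y u. ?f Y u * dir_deriv w k1 Y u) X e
        + b * transport c (\<lambda>Y u. ?f Y u * dir_deriv w k2 Y u) X e" for w
    by (intro transport_lincomb[OF U] fd k1 k2) (auto simp: kd algebra_simps)
  have t: "transport c k X e = a * transport c k1 X e + b * transport c k2 X e"
    by (intro transport_lincomb[OF U k] twice_diff_onD(1)[OF k1 U(2)] twice_diff_onD(1)[OF k2 U(2)])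
  have sum: "(\<Sum>\<sigma>\<in>UNIV. \<Sum>\<gamma>\<in>UNIV. m \<sigma> \<gamma> * (a * d1 \<sigma> + b * d2 \<sigma>) * r \<gamma>)
      = a * (\<Sum>\<sigma>\<in>UNIV. \<Sum>\<gamma>\<in>UNIV. m \<sigma> \<gamma> * d1 \<sigma> * r \<gamma>)
        + b * (\<Sum>\<sigma>\<in>UNIV. \<Sum>\<gamma>\<in>UNIV. m \<sigma> \<gamma> * d2 \<sigma> * r \<gamma>)"
    for m and d1 d2 r :: "3 \<Rightarrow> real"
    by (simp add: sum_distrib_left sum.distrib algebra_simps)
  show ?thesis
    unfolding B_term_def pd_e_eq pd_x_eq fk2 sum tf t kd[OF U(2)] k[OF U(2)]
    by (simp add: algebra_simps)
qed

section \<open>Smoothness of the objects attached to a chart\<close>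

text \<open>The radicand is a polynomial in \<open>e\<close> with twice differentiable coefficients,
  hence continuous, so its positivity is an open condition. Where it is positive, real powers of it
  are twice differentiable, and these yield \<open>ff\<close> and \<open>p_hat\<close>.\<close>

lemma
  assumes R: "open R" and G: "smooth_on R G"
  defines "W \<equiv> {(X, e). X \<in> R \<and> radicand (G X) e > 0}"
  shows open_timelike: "open W"
    and twice_diff_on_ff: "twice_diff_on W (case_prod (ff G))"
    and twice_diff_on_p_hat: "twice_diff_on W (case_prod (p_hat G))"
proof -
  have RU: "open (R \<times> (UNIV :: (real^3) set))"
    using R by (intro open_Times) auto
  have G2: "twice_diff_on (R \<times> (UNIV :: (real^3) set)) (\<lambda>z. G (fst z))"
    by (rule twice_diff_on_compose[OF RU smooth_on_imp_twice_diff_on[OF G]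
          twice_diff_on_bounded_linear[OF RU bounded_linear_fst twice_diff_on_id[OF RU]]]) auto
  have Gab: "twice_diff_on (R \<times> (UNIV :: (real^3) set)) (\<lambda>z. G (fst z) $ a $ b)" for a b
    using twice_diff_on_bounded_linear[OF RU bounded_linear_compose[OF bounded_linear_vec_nth
        bounded_linear_vec_nth] G2] .
  have e: "twice_diff_on (R \<times> (UNIV :: (real^3) set)) (\<lambda>z. snd z $ \<alpha>)" for \<alpha>
    using twice_diff_on_bounded_linear[OF RU bounded_linear_compose[OF bounded_linear_vec_nth
        bounded_linear_snd] twice_diff_on_id[OF RU]] .
  note [intro!] = twice_diff_on_add[OF RU] twice_diff_on_mult[OF RU] twice_diff_on_sum[OF RU]
    twice_diff_on_const[OF RU] Gab e
  have r: "twice_diff_on (R \<times> UNIV) (\<lambda>z. radicand (G (fst z)) (snd z))"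
    unfolding radicand_def by auto
  have n: "twice_diff_on (R \<times> UNIV)
      (\<lambda>z. G (fst z) $ a $ 0 + (\<Sum>\<alpha>\<in>UNIV. G (fst z) $ a $ sp \<alpha> * snd z $ \<alpha>))" for a
    by auto
  have W: "W = (R \<times> UNIV) \<inter> (\<lambda>z. radicand (G (fst z)) (snd z)) -` {0<..}"
    unfolding W_def by auto
  have "continuous_on (R \<times> UNIV) (\<lambda>z. radicand (G (fst z)) (snd z))"
    using twice_diff_onD(1)[OF r] differentiable_imp_continuous_within
      continuous_at_imp_continuous_on by blast
  then show oW: "open W"
    unfolding W using RU by (intro continuous_open_preimage) auto
  have sub: "twice_diff_on W F" if "twice_diff_on (R \<times> UNIV) F" for F :: "_ \<Rightarrow> real"
    using that unfolding W twice_diff_on_def by blast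
  have p: "twice_diff_on W (\<lambda>z. radicand (G (fst z)) (snd z) powr a)" for a
    by (rule twice_diff_on_compose[OF oW twice_diff_on_powr sub[OF r]]) (auto simp: W)
  show "twice_diff_on W (case_prod (ff G))"
    by (rule twice_diff_on_cong[OF oW p[of "1/2"]]) (auto simp: W ff_def powr_half_sqrt)
  \<comment> \<open>Division by \<open>ff\<close> becomes multiplication by a power of the radicand,
    to which \<open>p\<close> applies.\<close>
  have q: "x * r powr (- (1/2)) = x / sqrt r" if "r > 0" for x r :: real
    using that by (simp add: powr_minus_divide powr_half_sqrt)
  have "twice_diff_on W (\<lambda>z. \<chi> a. (G (fst z) $ a $ 0 + (\<Sum>\<alpha>\<in>UNIV. G (fst z) $ a $ sp \<alpha> * snd z $ \<alpha>))
      * radicand (G (fst z)) (snd z) powr (- (1/2)))"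
    by (intro twice_diff_on_vec_lambda[OF oW] twice_diff_on_mult[OF oW] p sub[OF n])
  then show "twice_diff_on W (case_prod (p_hat G))"
    by (rule twice_diff_on_cong[OF oW]) (auto simp: W p_hat_def ff_def vec_eq_iff q)
qed

lemma twice_diff_on_h_bar:
  assumes R: "open R" and G: "smooth_on R G" and h: "smooth_on (R \<times> UNIV) (case_prod h)"
  shows "twice_diff_on {(X, e). X \<in> R \<and> radicand (G X) e > 0} (case_prod (h_bar G h M))"
    (is "twice_diff_on ?W _")
proof -
  note oW = open_timelike[OF R G]
  have "twice_diff_on ?W (\<lambda>z. (fst z, M *\<^sub>R case_prod (p_hat G) z))"
    by (intro twice_diff_on_Pair[OF oW]
        twice_diff_on_bounded_linear[OF oW bounded_linear_fst twice_diff_on_id[OF oW]]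
        twice_diff_on_bounded_linear[OF oW bounded_linear_scaleR_right twice_diff_on_p_hat[OF R G]])
  from twice_diff_on_compose[OF oW smooth_on_imp_twice_diff_on[OF h] this]
  show ?thesis
    by (auto simp: h_bar_def[abs_def] case_prod_unfold)
qed

section \<open>Smooth functions on phase space\<close>

text \<open>\<open>Ck_on\<close> speaks of \<open>frechet_derivative\<close>, which the inductions
  below can compute only at points of \<open>U\<close>. This congruence lets them pass to the
  explicit formula.\<close>

lemma Ck_on_cong:
  assumes "open U" "Ck_on k U f" "\<And>z. z \<in> U \<Longrightarrow> f z = g z"
  shows "Ck_on k U g"
  using assms(2,3)
proof (induction k arbitrary: f g)
  case 0 then show ?case by (simp cong: continuous_on_cong)
next
  case (Suc k)
  have "g differentiable (at z)" if "z \<in> U" for z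
    using Suc.prems that differentiable_transform_open[OF _ assms(1) that] by simp blast
  moreover have "Ck_on k U (\<lambda>x. frechet_derivative g (at x) v)" for v
    by (rule Suc.IH[of "\<lambda>x. frechet_derivative f (at x) v"])
      (use Suc.prems frechet_derivative_transform_open[OF _ assms(1), of f _ g] in auto)
  ultimately show ?case by simp
qed

lemma Ck_on_lincomb:
  fixes f g :: "'a::real_normed_vector \<Rightarrow> real"
  assumes "open U" "Ck_on k U f" "Ck_on k U g"
  shows "Ck_on k U (\<lambda>z. a * f z + b * g z)"
  using assms(2,3)
proof (induction k arbitrary: f g)
  case 0 then show ?case by (auto intro!: continuous_intros)
next
  case (Suc k)
  have d: "((\<lambda>z. a * f z + b * g z) has_derivative
      (\<lambda>v. a * frechet_derivative f (at z) v + b * frechet_derivative g (at z) v)) (at z)"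
    if "z \<in> U" for z
    using Suc.prems that by (intro has_derivative_add has_derivative_mult_right)
      (auto simp: frechet_derivative_works)
  have "Ck_on k U (\<lambda>x. frechet_derivative (\<lambda>z. a * f z + b * g z) (at x) v)" for v
  proof (rule Ck_on_cong[OF assms(1)])
    show "Ck_on k U (\<lambda>x. a * frechet_derivative f (at x) v + b * frechet_derivative g (at x) v)"
      using Suc by auto
  qed (simp add: frechet_derivative_at[OF d, symmetric])
  then show ?case
    using differentiableI[OF d] by simp
qed

text \<open>Since \<open>L\<close> is linear, the derivative of the composition along
  \<open>v\<close> is the derivative of \<open>f\<close> along the fixed direction
  \<open>L v\<close>, composed with \<open>L\<close>. This has the same shape with one order less,
  so the induction closes.\<close>

lemma Ck_on_compose_linear:
  assumes "open U" "bounded_linear L" "\<And>z. z \<in> U \<Longrightarrow> L z \<in> V" "Ck_on k V f"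
  shows "Ck_on k U (\<lambda>z. f (L z))"
  using assms(4)
proof (induction k arbitrary: f)
  case 0
  then show ?case
    using assms(3) by (auto intro!: continuous_on_compose2[of V f] linear_continuous_on[OF assms(2)])
next
  case (Suc k)
  have d: "((\<lambda>z. f (L z)) has_derivative (\<lambda>v. frechet_derivative f (at (L z)) (L v))) (at z)"
    if "z \<in> U" for z
    using diff_chain_at[OF bounded_linear_imp_has_derivative[OF assms(2)],
        of f "frechet_derivative f (at (L z))" z] Suc.prems assms(3)[OF that]
    by (auto simp: frechet_derivative_works o_def)
  have "Ck_on k U (\<lambda>x. frechet_derivative (\<lambda>z. f (L z)) (at x) v)" for v
  proof (rule Ck_on_cong[OF assms(1)])
    show "Ck_on k U (\<lambda>x. frechet_derivative f (at (L x)) (L v))"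
      using Suc.IH[of "\<lambda>x. frechet_derivative f (at x) (L v)"] Suc.prems by auto
  qed (simp add: frechet_derivative_at[OF d, symmetric])
  then show ?case
    using differentiableI[OF d] by simp
qed

text \<open>Zero serves as the trivial part when exact homogeneity is shown to imply the equivalence
  principle.\<close>

lemma phase_space_function_zero: "phase_space_function A (\<lambda>\<kappa> X p. 0)"
proof -
  have "Ck_on k U (\<lambda>z. 0::real)" for k and U :: "((real^4) \<times> (real^4)) set"
    by (induction k) auto
  then show ?thesis
    by (auto simp: phase_space_function_def smooth_on_def case_prod_unfold)
qed

text \<open>The trivial part \<open>q M\<close> constructed below has this form. Covariance survives
  because covectors transform linearly, so rescaling the momentum commutes with a change of
  chart.\<close>

lemma phase_space_function_rescaled_lincomb:
  assumes R: "\<And>\<kappa>. \<kappa> \<in> A \<Longrightarrow> open (coord_range \<kappa>)" and h: "phase_space_function A h"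
  shows "phase_space_function A (\<lambda>\<kappa> X p. a * h \<kappa> X p + b * h \<kappa> X (l *\<^sub>R p))"
  unfolding phase_space_function_def
proof (intro conjI ballI allI)
  fix \<kappa> assume \<kappa>: "\<kappa> \<in> A"
  have o: "open (coord_range \<kappa> \<times> (UNIV :: (real^4) set))"
    using R[OF \<kappa>] by (intro open_Times) auto
  have L: "bounded_linear (\<lambda>z::(real^4)\<times>(real^4). (fst z, l *\<^sub>R snd z))"
    by (intro bounded_linear_Pair bounded_linear_fst
        bounded_linear_compose[OF bounded_linear_scaleR_right bounded_linear_snd])
  have s: "Ck_on k (coord_range \<kappa> \<times> UNIV) (case_prod (h \<kappa>))" for k
    using h \<kappa> by (auto simp: phase_space_function_def smooth_on_def)
  from Ck_on_lincomb[OF o s Ck_on_compose_linear[OF o L _ s], where a = a and b = b]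
  show "smooth_on (coord_range \<kappa> \<times> UNIV) (\<lambda>(X, p). a * h \<kappa> X p + b * h \<kappa> X (l *\<^sub>R p))"
    by (auto simp: smooth_on_def case_prod_unfold)
next
  fix \<kappa> \<mu> X and p :: "real^4" assume "\<kappa> \<in> A" "\<mu> \<in> A" "X \<in> overlap \<kappa> \<mu>"
  then have "h \<kappa> X (transpose (jacobian \<kappa> \<mu> X) *v p) = h \<mu> (transition \<kappa> \<mu> X) p" for p
    using h by (auto simp: phase_space_function_def)
  from this[of p] this[of "l *\<^sub>R p"]
  show "a * h \<kappa> X (transpose (jacobian \<kappa> \<mu> X) *v p) + b * h \<kappa> X (l *\<^sub>R (transpose (jacobian \<kappa> \<mu> X) *v p))
      = a * h \<mu> (transition \<kappa> \<mu> X) p + b * h \<mu> (transition \<kappa> \<mu> X) (l *\<^sub>R p)"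
    by (simp add: matrix_vector_mult_scaleR)
qed

section \<open>The weak equivalence principle\<close>

text \<open>Two functions and two masses are allowed because both kinds of combination occur:
  different mass shells of \<open>h\<close>, and \<open>h\<close> with a trivial part on the same
  shell.\<close>

lemma B_term_lincomb_h_bar:
  assumes "smooth_atlas S A" "lorentzian_metric A g"
    and "phase_space_function A h1" "phase_space_function A h2"
    and "\<kappa> \<in> A" "(X, e) \<in> states \<kappa> g"
    and "\<And>Y u. (Y, u) \<in> states \<kappa> g \<Longrightarrow>
      k Y u = a * h_bar (g \<kappa>) (h1 \<kappa>) M1 Y u + b * h_bar (g \<kappa>) (h2 \<kappa>) M2 Y u"
  shows "B_term c (g \<kappa>) k \<alpha> X e = a * B_term c (g \<kappa>) (h_bar (g \<kappa>) (h1 \<kappa>) M1) \<alpha> X e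
    + b * B_term c (g \<kappa>) (h_bar (g \<kappa>) (h2 \<kappa>) M2) \<alpha> X e"
proof -
  have R: "open (coord_range \<kappa>)" and G: "smooth_on (coord_range \<kappa>) (g \<kappa>)"
    and h: "smooth_on (coord_range \<kappa> \<times> UNIV) (case_prod (h1 \<kappa>))"
      "smooth_on (coord_range \<kappa> \<times> UNIV) (case_prod (h2 \<kappa>))"
    using assms(1-5) by (auto simp: smooth_atlas_def lorentzian_metric_def phase_space_function_def)
  show ?thesis
    using assms(6,7) open_timelike[OF R G] twice_diff_on_ff[OF R G]
      twice_diff_on_h_bar[OF R G h(1)] twice_diff_on_h_bar[OF R G h(2)]
    unfolding states_def[symmetric] by (intro B_term_lincomb) auto
qed

lemma vector_matrix_mult_inv_cancel:
  fixes H :: "real^'n^'n"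
  assumes "invertible H"
  shows "u v* matrix_inv H = v v* matrix_inv H \<longleftrightarrow> u = v"
proof
  assume "u v* matrix_inv H = v v* matrix_inv H"
  then have "(u v* matrix_inv H) v* H = (v v* matrix_inv H) v* H" by simp
  \<comment> \<open>\<open>matrix_inv\<close> chooses some two-sided inverse, so its property
    follows from the existence stated by \<open>invertible\<close>.\<close>
  moreover have "matrix_inv H ** H = mat 1"
    using someI_ex[OF assms[unfolded invertible_def]] unfolding matrix_inv_def by simp
  ultimately show "u = v"
    by (simp add: vector_matrix_mul_assoc)
qed simp

text \<open>The inverse Hessian cancels by invertibility, \<open>a_GR\<close> is the same for all
  masses and drops out, and so does the common factor 1/2.\<close>

lemma weak_equivalence_principle_iff:
  assumes "\<forall>\<kappa>\<in>A. \<forall>(X, e)\<in>states \<kappa> g. invertible (hess_f (g \<kappa>) X e)"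
  shows "weak_equivalence_principle c A g h \<Xi> \<longleftrightarrow>
    (\<forall>\<kappa>\<in>A. \<forall>(X, e)\<in>states \<kappa> g. \<forall>M>0. \<forall>M'>0. \<forall>\<alpha>.
      \<Xi> M / M\<^sup>2 * B_term c (g \<kappa>) (h_bar (g \<kappa>) (h \<kappa>) M) \<alpha> X e
      = \<Xi> M' / M'\<^sup>2 * B_term c (g \<kappa>) (h_bar (g \<kappa>) (h \<kappa>) M') \<alpha> X e)"
proof -
  have "spatial_acceleration c (g \<kappa>) (h \<kappa>) (\<Xi> M) M X e
        = spatial_acceleration c (g \<kappa>) (h \<kappa>) (\<Xi> M') M' X e \<longleftrightarrow>
      (\<forall>\<alpha>. \<Xi> M / M\<^sup>2 * B_term c (g \<kappa>) (h_bar (g \<kappa>) (h \<kappa>) M) \<alpha> X e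
        = \<Xi> M' / M'\<^sup>2 * B_term c (g \<kappa>) (h_bar (g \<kappa>) (h \<kappa>) M') \<alpha> X e)"
    if "\<kappa> \<in> A" "(X, e) \<in> states \<kappa> g" for \<kappa> X e M M'
  proof -
    have H: "invertible (hess_f (g \<kappa>) X e)" using assms that by auto
    have half: "a - x / (2 * m) * y = a - x' / (2 * m') * y' \<longleftrightarrow> x / m * y = x' / m' * y'"
      for a x y m x' y' m' :: real
    proof -
      have "x / (2 * m) * y = (x / m * y) / 2" "x' / (2 * m') * y' = (x' / m' * y') / 2" by simp_all
      then show ?thesis by linarith
    qed
    show ?thesis
      unfolding spatial_acceleration_def vector_matrix_mult_inv_cancel[OF H]
      by (simp only: vec_eq_iff vec_lambda_beta half)
  qed
  then show ?thesis
    unfolding weak_equivalence_principle_def by fast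
qed

text \<open>Linearity merges the two sides into \<open>B_term\<close> of a single combination of two
  mass shells, the form to which \<open>no_trivial_part\<close> applies.\<close>

lemma weak_equivalence_principle_iff_B_term_diff:
  assumes "smooth_atlas S A" "lorentzian_metric A g" "phase_space_function A h"
    and "\<forall>\<kappa>\<in>A. \<forall>(X, e)\<in>states \<kappa> g. invertible (hess_f (g \<kappa>) X e)"
  shows "weak_equivalence_principle c A g h \<Xi> \<longleftrightarrow>
    (\<forall>M>0. \<forall>M'>0. \<forall>\<kappa>\<in>A. \<forall>(X, e)\<in>states \<kappa> g. \<forall>\<alpha>.
      B_term c (g \<kappa>) (\<lambda>Y u. \<Xi> M / M\<^sup>2 * h_bar (g \<kappa>) (h \<kappa>) M Y u
        + (- (\<Xi> M' / M'\<^sup>2)) * h_bar (g \<kappa>) (h \<kappa>) M' Y u) \<alpha> X e = 0)"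
proof -
  have "B_term c (g \<kappa>) (\<lambda>Y u. \<Xi> M / M\<^sup>2 * h_bar (g \<kappa>) (h \<kappa>) M Y u
        + (- (\<Xi> M' / M'\<^sup>2)) * h_bar (g \<kappa>) (h \<kappa>) M' Y u) \<alpha> X e = 0 \<longleftrightarrow>
      \<Xi> M / M\<^sup>2 * B_term c (g \<kappa>) (h_bar (g \<kappa>) (h \<kappa>) M) \<alpha> X e
      = \<Xi> M' / M'\<^sup>2 * B_term c (g \<kappa>) (h_bar (g \<kappa>) (h \<kappa>) M') \<alpha> X e"
    if "\<kappa> \<in> A" "(X, e) \<in> states \<kappa> g" for M M' \<kappa> X e \<alpha>
    by (subst B_term_lincomb_h_bar[OF assms(1-3) assms(3) that refl]) simp
  then show ?thesis
    unfolding weak_equivalence_principle_iff[OF assms(4)] by fast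
qed

text \<open>All masses are compared with the reference mass 1: one direction scales mass 1 by the
  factor \<open>M\<close>, the other reduces both \<open>M\<close> and \<open>l * M\<close> to mass
  1.\<close>

lemma mass_homogeneous2_iff:
  "mass_homogeneous2 A g Q \<longleftrightarrow>
    (\<forall>\<kappa>\<in>A. \<forall>(X, e)\<in>states \<kappa> g. \<forall>M>0.
      h_bar (g \<kappa>) (Q M \<kappa>) M X e = M\<^sup>2 * h_bar (g \<kappa>) (Q 1 \<kappa>) 1 X e)" (is "_ \<longleftrightarrow> ?R")
proof
  assume Q: "mass_homogeneous2 A g Q"
  show ?R
  proof clarify
    fix \<kappa> X e and M :: real assume "\<kappa> \<in> A" "(X, e) \<in> states \<kappa> g" "0 < M"
    then have "h_bar (g \<kappa>) (Q (M * 1) \<kappa>) (M * 1) X e = M\<^sup>2 * h_bar (g \<kappa>) (Q 1 \<kappa>) 1 X e"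
      using Q zero_less_one unfolding mass_homogeneous2_def by blast
    then show "h_bar (g \<kappa>) (Q M \<kappa>) M X e = M\<^sup>2 * h_bar (g \<kappa>) (Q 1 \<kappa>) 1 X e" by simp
  qed
next
  assume R: ?R
  show "mass_homogeneous2 A g Q"
    unfolding mass_homogeneous2_def
  proof clarify
    fix \<kappa> X e and M l :: real assume *: "\<kappa> \<in> A" "(X, e) \<in> states \<kappa> g" "0 < M" "0 < l"
    then have "h_bar (g \<kappa>) (Q M \<kappa>) M X e = M\<^sup>2 * h_bar (g \<kappa>) (Q 1 \<kappa>) 1 X e"
      "h_bar (g \<kappa>) (Q (l * M) \<kappa>) (l * M) X e = (l * M)\<^sup>2 * h_bar (g \<kappa>) (Q 1 \<kappa>) 1 X e"
      using R mult_pos_pos[OF *(4,3)] by blast+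
    then show "h_bar (g \<kappa>) (Q (l * M) \<kappa>) (l * M) X e = l\<^sup>2 * h_bar (g \<kappa>) (Q M \<kappa>) M X e"
      by (simp add: power_mult_distrib)
  qed
qed

text \<open>On the shell of mass \<open>M\<close>, the trivial part \<open>q M\<close> restricts to
  \<open>M\<^sup>2\<close> times the difference of \<open>\<Xi> M / M\<^sup>2 * h_bar\<close> at
  mass \<open>M\<close> and \<open>\<Xi> 1 * h_bar\<close> at mass 1. The equivalence principle says
  that \<open>B_term\<close> annihilates this difference.\<close>

lemma weak_equivalence_principle_imp_homogeneous_mod_trivial:
  assumes "smooth_atlas S A" "lorentzian_metric A g" "phase_space_function A h"
    and "\<forall>\<kappa>\<in>A. \<forall>(X, e)\<in>states \<kappa> g. invertible (hess_f (g \<kappa>) X e)"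
    and wep: "weak_equivalence_principle c A g h \<Xi>"
  shows "\<exists>q. (\<forall>M>0. phase_space_function A (q M) \<and> dynamically_trivial_at c A g (q M) M) \<and>
             mass_homogeneous2 A g (\<lambda>M \<kappa> X p. \<Xi> M * h \<kappa> X p - q M \<kappa> X p)"
proof (intro exI conjI allI impI)
  \<comment> \<open>Subtracting \<open>q M\<close> replaces the perturbation at mass \<open>M\<close> by the one at mass \<open>1\<close>, rescaled.\<close>
  define q where "q M = (\<lambda>\<kappa> X p. \<Xi> M * h \<kappa> X p + (- (M\<^sup>2 * \<Xi> 1)) * h \<kappa> X ((1 / M) *\<^sub>R p))" for M
  show "mass_homogeneous2 A g (\<lambda>M \<kappa> X p. \<Xi> M * h \<kappa> X p - q M \<kappa> X p)"
    unfolding mass_homogeneous2_iff by (auto simp: h_bar_def q_def)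
  fix M :: real assume M: "0 < M"
  have R: "open (coord_range \<kappa>)" if "\<kappa> \<in> A" for \<kappa>
    using assms(1) that by (auto simp: smooth_atlas_def)
  show "phase_space_function A (q M)"
    unfolding q_def by (rule phase_space_function_rescaled_lincomb[OF R assms(3)])
  show "dynamically_trivial_at c A g (q M) M"
    unfolding dynamically_trivial_at_def
  proof clarify
    fix \<kappa> X e \<alpha> assume *: "\<kappa> \<in> A" "(X, e) \<in> states \<kappa> g"
    have "\<Xi> M / M\<^sup>2 * B_term c (g \<kappa>) (h_bar (g \<kappa>) (h \<kappa>) M) \<alpha> X e
      = \<Xi> 1 / 1\<^sup>2 * B_term c (g \<kappa>) (h_bar (g \<kappa>) (h \<kappa>) 1) \<alpha> X e"
      using wep * M zero_less_one unfolding weak_equivalence_principle_iff[OF assms(4)] by blast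
    \<comment> \<open>The factors \<open>1 / M\<close> and \<open>M\<close> in the momentum cancel,
      so the second term of \<open>q M\<close>, taken at mass \<open>M\<close>, involves
      \<open>h\<close> on the shell of mass 1.\<close>
    moreover have "B_term c (g \<kappa>) (h_bar (g \<kappa>) (q M \<kappa>) M) \<alpha> X e
      = \<Xi> M * B_term c (g \<kappa>) (h_bar (g \<kappa>) (h \<kappa>) M) \<alpha> X e
        + (- (M\<^sup>2 * \<Xi> 1)) * B_term c (g \<kappa>) (h_bar (g \<kappa>) (h \<kappa>) 1) \<alpha> X e"
      by (rule B_term_lincomb_h_bar[OF assms(1-3) assms(3) *]) (use M in \<open>auto simp: h_bar_def q_def\<close>)
    ultimately show "B_term c (g \<kappa>) (h_bar (g \<kappa>) (q M \<kappa>) M) \<alpha> X e = 0"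
      using M by (simp add: field_simps)
  qed
qed

text \<open>Removing the trivial \<open>q M\<close> does not change \<open>B_term\<close>, and the
  homogeneous remainder makes it scale like \<open>M\<^sup>2\<close>. Division by
  \<open>M\<^sup>2\<close> therefore gives the value at mass 1 for every \<open>M\<close>.\<close>

lemma homogeneous_mod_trivial_imp_weak_equivalence_principle:
  assumes "smooth_atlas S A" "lorentzian_metric A g" "phase_space_function A h"
    and "\<forall>\<kappa>\<in>A. \<forall>(X, e)\<in>states \<kappa> g. invertible (hess_f (g \<kappa>) X e)"
    and q: "\<And>M. M > 0 \<Longrightarrow> phase_space_function A (q M)"
      "\<And>M. M > 0 \<Longrightarrow> dynamically_trivial_at c A g (q M) M"
    and hom: "mass_homogeneous2 A g (\<lambda>M \<kappa> X p. \<Xi> M * h \<kappa> X p - q M \<kappa> X p)"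
  shows "weak_equivalence_principle c A g h \<Xi>"
proof -
  have "\<Xi> M / M\<^sup>2 * B_term c (g \<kappa>) (h_bar (g \<kappa>) (h \<kappa>) M) \<alpha> X e
      = \<Xi> 1 * B_term c (g \<kappa>) (h_bar (g \<kappa>) (h \<kappa>) 1) \<alpha> X e"
    if *: "\<kappa> \<in> A" "(X, e) \<in> states \<kappa> g" and M: "M > 0" for \<kappa> X e M \<alpha>
  proof -
    let ?D = "\<lambda>M Y u. \<Xi> M * h_bar (g \<kappa>) (h \<kappa>) M Y u + (- 1) * h_bar (g \<kappa>) (q M \<kappa>) M Y u"
    have D: "B_term c (g \<kappa>) (?D M) \<alpha> X e = \<Xi> M * B_term c (g \<kappa>) (h_bar (g \<kappa>) (h \<kappa>) M) \<alpha> X e"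
      if "M > 0" for M
    proof -
      have "B_term c (g \<kappa>) (h_bar (g \<kappa>) (q M \<kappa>) M) \<alpha> X e = 0"
        using q(2)[OF that] * unfolding dynamically_trivial_at_def by blast
      then show ?thesis
        by (subst B_term_lincomb_h_bar[OF assms(1-3) q(1)[OF that] * refl]) simp
    qed
    \<comment> \<open>Homogeneity is recorded at all states and not just at \<open>(X, e)\<close>,
      so that \<open>?D M\<close> may be differentiated as a multiple of
      \<open>?D 1\<close>.\<close>
    have hD: "?D M Y u = M\<^sup>2 * ?D 1 Y u" if "(Y, u) \<in> states \<kappa> g" for Y u
      using hom *(1) that M unfolding mass_homogeneous2_iff by (fastforce simp: h_bar_def)
    have "B_term c (g \<kappa>) (?D M) \<alpha> X e = M\<^sup>2 * \<Xi> 1 * B_term c (g \<kappa>) (h_bar (g \<kappa>) (h \<kappa>) 1) \<alpha> X e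
        + (- (M\<^sup>2)) * B_term c (g \<kappa>) (h_bar (g \<kappa>) (q 1 \<kappa>) 1) \<alpha> X e"
      by (rule B_term_lincomb_h_bar[OF assms(1-3) q(1)[OF zero_less_one] *])
        (simp add: hD[simplified] algebra_simps)
    moreover have "B_term c (g \<kappa>) (h_bar (g \<kappa>) (q 1 \<kappa>) 1) \<alpha> X e = 0"
      using q(2)[OF zero_less_one] * unfolding dynamically_trivial_at_def by blast
    ultimately show ?thesis
      using M D[OF M] by (simp add: field_simps)
  qed
  then show ?thesis
    unfolding weak_equivalence_principle_iff[OF assms(4)] by (auto split: prod.splits)
qed

text \<open>The equivalence principle puts the combination of the shells of mass \<open>M\<close>
  and 1 with coefficients \<open>\<Xi> M / M\<^sup>2\<close> and \<open>- \<Xi> 1\<close> into the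
  kernel of \<open>B_term\<close>. By \<open>no_trivial_part\<close> the combination itself then
  vanishes.\<close>

lemma weak_equivalence_principle_imp_mass_homogeneous2:
  assumes "smooth_atlas S A" "lorentzian_metric A g" "phase_space_function A h"
    and "\<forall>\<kappa>\<in>A. \<forall>(X, e)\<in>states \<kappa> g. invertible (hess_f (g \<kappa>) X e)"
    and ntp: "no_trivial_part c A g h"
    and wep: "weak_equivalence_principle c A g h \<Xi>"
  shows "mass_homogeneous2 A g (\<lambda>M \<kappa> X p. \<Xi> M * h \<kappa> X p)"
  unfolding mass_homogeneous2_iff
proof clarify
  fix \<kappa> X e and M :: real assume *: "\<kappa> \<in> A" "(X, e) \<in> states \<kappa> g" and M: "0 < M"
  have "\<forall>\<kappa>\<in>A. \<forall>(X, e)\<in>states \<kappa> g. \<forall>\<alpha>.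
      B_term c (g \<kappa>) (\<lambda>Y u. \<Xi> M / M\<^sup>2 * h_bar (g \<kappa>) (h \<kappa>) M Y u
        + (- (\<Xi> 1 / 1\<^sup>2)) * h_bar (g \<kappa>) (h \<kappa>) 1 Y u) \<alpha> X e = 0"
    using wep M zero_less_one
    unfolding weak_equivalence_principle_iff_B_term_diff[OF assms(1-4)] by blast
  then have "\<Xi> M / M\<^sup>2 * h_bar (g \<kappa>) (h \<kappa>) M X e + (- (\<Xi> 1 / 1\<^sup>2)) * h_bar (g \<kappa>) (h \<kappa>) 1 X e = 0"
    using ntp * M zero_less_one unfolding no_trivial_part_def Let_def by blast
  then show "h_bar (g \<kappa>) (\<lambda>X p. \<Xi> M * h \<kappa> X p) M X e
      = M\<^sup>2 * h_bar (g \<kappa>) (\<lambda>X p. \<Xi> 1 * h \<kappa> X p) 1 X e"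
    using M by (simp add: h_bar_def field_simps)
qed

section \<open>Perturbations homogeneous in the momentum\<close>

lemma h_bar_momentum_homogeneous:
  assumes "momentum_homogeneous A n h" "\<kappa> \<in> A" "(X, e) \<in> states \<kappa> g" "M > 0"
  shows "h_bar (g \<kappa>) (h \<kappa>) M X e = M powr n * h_bar (g \<kappa>) (h \<kappa>) 1 X e"
  using assms by (auto simp: momentum_homogeneous_def h_bar_def states_def)

text \<open>All mass shells of \<open>h\<close> are positive multiples of one function, so a state
  where \<open>B_term\<close> is nonzero for some mass serves for every mass. There the nonzero
  value cancels from the equivalence principle, which leaves an equation for \<open>\<Xi> M\<close>
  alone.\<close>

lemma momentum_homogeneous_coupling:
  assumes "smooth_atlas S A" "lorentzian_metric A g" "phase_space_function A h"
    and "\<forall>\<kappa>\<in>A. \<forall>(X, e)\<in>states \<kappa> g. invertible (hess_f (g \<kappa>) X e)"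
    and nontriv: "\<not> dynamically_trivial c A g h"
    and hom: "momentum_homogeneous A n h"
    and wep: "weak_equivalence_principle c A g h \<Xi>"
    and M: "M > 0"
  shows "\<Xi> M = M powr (2 - n) * \<Xi> 1"
proof -
  have B: "B_term c (g \<kappa>) (h_bar (g \<kappa>) (h \<kappa>) M) \<alpha> X e
      = M powr n * B_term c (g \<kappa>) (h_bar (g \<kappa>) (h \<kappa>) 1) \<alpha> X e"
    if "\<kappa> \<in> A" "(X, e) \<in> states \<kappa> g" "M > 0" for \<kappa> X e \<alpha> M
    using B_term_lincomb_h_bar[OF assms(1-3) assms(3) that(1,2),
        where k = "h_bar (g \<kappa>) (h \<kappa>) M" and a = "M powr n" and b = 0 and ?M1.0 = 1 and ?M2.0 = 1]
      h_bar_momentum_homogeneous[OF hom that(1) _ that(3)] by simp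
  obtain M' \<kappa> X e \<alpha> where M': "M' > 0" and *: "\<kappa> \<in> A" "(X, e) \<in> states \<kappa> g"
    and "B_term c (g \<kappa>) (h_bar (g \<kappa>) (h \<kappa>) M') \<alpha> X e \<noteq> 0"
    using nontriv unfolding dynamically_trivial_def dynamically_trivial_at_def by blast
  then have nz: "B_term c (g \<kappa>) (h_bar (g \<kappa>) (h \<kappa>) 1) \<alpha> X e \<noteq> 0"
    using B[OF * M'] by auto
  have "\<Xi> M / M\<^sup>2 * B_term c (g \<kappa>) (h_bar (g \<kappa>) (h \<kappa>) M) \<alpha> X e
      = \<Xi> 1 / 1\<^sup>2 * B_term c (g \<kappa>) (h_bar (g \<kappa>) (h \<kappa>) 1) \<alpha> X e"
    using wep * M zero_less_one unfolding weak_equivalence_principle_iff[OF assms(4)] by blast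
  then have "\<Xi> M = M\<^sup>2 / M powr n * \<Xi> 1"
    using nz M unfolding B[OF * M] by (simp add: field_simps)
  then show ?thesis
    using M by (simp add: powr_diff)
qed

theorem theorem1:
  fixes c :: real
    and S :: "'s::{t2_space, second_countable_topology} set"
    and A :: "'s chart set"
    and g :: "'s chart \<Rightarrow> real ^ 4 \<Rightarrow> real ^ 4 ^ 4"
    and h :: "'s chart \<Rightarrow> real ^ 4 \<Rightarrow> real ^ 4 \<Rightarrow> real"
    and \<Xi> :: "real \<Rightarrow> real"
  assumes "c > 0"
    and "smooth_atlas S A"
    and "lorentzian_metric A g"
    and "phase_space_function A h"
    and "\<forall>\<kappa>\<in>A. \<forall>(X, e)\<in>states \<kappa> g. invertible (hess_f (g \<kappa>) X e)"
    and "\<not> dynamically_trivial c A g h"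
  shows
    "(weak_equivalence_principle c A g h \<Xi> \<longleftrightarrow>
        (\<exists>q. (\<forall>M>0. phase_space_function A (q M) \<and> dynamically_trivial_at c A g (q M) M) \<and>
             mass_homogeneous2 A g (\<lambda>M \<kappa> X p. \<Xi> M * h \<kappa> X p - q M \<kappa> X p))) \<and>
     (mass_homogeneous2 A g (\<lambda>M \<kappa> X p. \<Xi> M * h \<kappa> X p) \<longrightarrow>
        weak_equivalence_principle c A g h \<Xi>) \<and>
     (no_trivial_part c A g h \<longrightarrow>
        (weak_equivalence_principle c A g h \<Xi> \<longleftrightarrow>
         mass_homogeneous2 A g (\<lambda>M \<kappa> X p. \<Xi> M * h \<kappa> X p))) \<and>
     (\<forall>n. momentum_homogeneous A n h \<longrightarrow>
        (weak_equivalence_principle c A g h \<Xi> \<longleftrightarrow>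
         mass_homogeneous2 A g (\<lambda>M \<kappa> X p. \<Xi> M * h \<kappa> X p)) \<and>
        (weak_equivalence_principle c A g h \<Xi> \<longrightarrow>
         (\<exists>\<Xi>_hat. \<forall>M>0. \<Xi> M = M powr (2 - n) * \<Xi>_hat)))"
proof -
  let ?wep = "weak_equivalence_principle c A g h \<Xi>"
  let ?hom = "mass_homogeneous2 A g (\<lambda>M \<kappa> X p. \<Xi> M * h \<kappa> X p)"
  let ?mod = "\<exists>q. (\<forall>M>0. phase_space_function A (q M) \<and> dynamically_trivial_at c A g (q M) M) \<and>
             mass_homogeneous2 A g (\<lambda>M \<kappa> X p. \<Xi> M * h \<kappa> X p - q M \<kappa> X p)"
  note a = assms(2-5)
  have 1: "?wep \<longleftrightarrow> ?mod"
    using weak_equivalence_principle_imp_homogeneous_mod_trivial[OF a]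
      homogeneous_mod_trivial_imp_weak_equivalence_principle[OF a] by blast
  \<comment> \<open>Zero is the combination with both coefficients 0, so linearity gives the value
    of \<open>B_term\<close> on it.\<close>
  have "B_term c (g \<kappa>) (h_bar (g \<kappa>) (\<lambda>X p. 0) M) \<alpha> X e = 0"
    if "\<kappa> \<in> A" "(X, e) \<in> states \<kappa> g" for \<kappa> X e \<alpha> M
    using B_term_lincomb_h_bar[OF a(1-3) a(3) that,
        where k = "h_bar (g \<kappa>) (\<lambda>X p. 0) M" and a = 0 and b = 0] by (simp add: h_bar_def)
  then have "dynamically_trivial_at c A g (\<lambda>\<kappa> X p. 0) M" for M
    unfolding dynamically_trivial_at_def by blast
  then have 2: "?hom \<longrightarrow> ?wep"
    using homogeneous_mod_trivial_imp_weak_equivalence_principle[OF a, of "\<lambda>M \<kappa> X p. 0"]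
    by (simp add: phase_space_function_zero)
  have 3: "no_trivial_part c A g h \<longrightarrow> (?wep \<longleftrightarrow> ?hom)"
    using 2 weak_equivalence_principle_imp_mass_homogeneous2[OF a] by blast
  have 4: "\<Xi> M = M powr (2 - n) * \<Xi> 1"
    if "momentum_homogeneous A n h" ?wep "M > 0" for n M
    using momentum_homogeneous_coupling[OF a assms(6) that] .
  \<comment> \<open>The exact degree 2 comes from the coupling in \<open>4\<close>: its exponent
    \<open>2 - n\<close> and the degree \<open>n\<close> of \<open>h\<close> add up to 2.\<close>
  have 5: "?hom" if n: "momentum_homogeneous A n h" and ?wep for n
    unfolding mass_homogeneous2_iff
  proof clarify
    fix \<kappa> X e and M :: real assume *: "\<kappa> \<in> A" "(X, e) \<in> states \<kappa> g" and M: "0 < M"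
    have "M powr (2 - n) * M powr n = M\<^sup>2"
      using M by (simp add: powr_add[symmetric])
    then show "h_bar (g \<kappa>) (\<lambda>X p. \<Xi> M * h \<kappa> X p) M X e
        = M\<^sup>2 * h_bar (g \<kappa>) (\<lambda>X p. \<Xi> 1 * h \<kappa> X p) 1 X e"
      using 4[OF n \<open>?wep\<close> M] h_bar_momentum_homogeneous[OF n * M]
      by (simp add: h_bar_def algebra_simps)
  qed
  show ?thesis
    using 1 2 3 4 5 by blast
qed

end
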